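(* Let $\gamma>0$ and let $\boldsymbol\Xi$ be a splitting measure on $\mathcal E$. (a) If $\boldsymbol\Xi$ has form $\mathsf M_\gamma$, then $(\boldsymbol\Xi;\gamma)$ is $G^{\mathsf M}$-growing for $$G_x^{\mathsf M}(y_0,\mathbf y)=\Big(\mathsf m_x(y_0),\frac{1-\mathsf m_x(y_0)}{1-y_0}\cdot\mathbf y\Big),\qquad(y_0,\mathbf y)\in\mathcal E,\ 0<y_0<1,\quad x>0.$$ (b) If $\boldsymbol\Xi$ has form $\mathsf H_\gamma$, then $(\boldsymbol\Xi;\gamma)$ is $G^{\mathsf H}$-growing for $$G_x^{\mathsf H}(1,y_1,\mathbf y)=\Big(1,\mathsf m_{x^{-1}}(y_1),\frac{\mathsf m_{x^{-1}}(y_1)}{y_1}\cdot\mathbf y\Big),\qquad(1,y_1,\mathbf y)\in\mathcal E,\ 0<y_1<1,\quad x>0.$$ In both cases $G_x$ is extended by the identity to the rest of $\mathcal E$, which is a $\boldsymbol\Xi$-null set.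
   Context: **Splitting measures.** $\mathcal E$ is the set of sequences $\mathbf y=(y_0,y_1,y_2,\dots)$ with $y_0>0$, $y_1\ge y_2\ge\cdots\ge0$, $y_i\to0$, with the supremum-norm topology. $\mathcal E^\downarrow$ denotes the set of non-increasing sequences $(y_0\ge y_1\ge\cdots\ge0)$ tending to $0$. A splitting measure is a Borel measure $\boldsymbol\Xi$ on $\mathcal E$ such that, $\Xi_0$ denoting its image by $\mathbf y\mapsto y_0$, $\int(1\wedge(\log y_0)^2)\,\Xi_0(\mathrm dy_0)<\infty$, $\boldsymbol\Xi(\{y_1>\varepsilon\})<\infty$ for all $\varepsilon>0$, and (standing assumption) $\int(y_0-1)^2\,\Xi_0(\mathrm dy_0)<\infty$. **Growing.** For $\alpha>0$, $(\boldsymbol\Xi;\alpha)$ is $G$-growing for a family $G=(G_x:x>0)$ of maps $\mathcal E\to\mathcal E$ if there is a measurable $\mathcal E_0\subset\mathcal E$ with $\boldsymbol\Xi(\mathcal E\setminus\mathcal E_0)=0$ such that: (1) $G_1=\mathrm{Id}$ and $G_x\circ G_{x'}=G_{xx'}$ for all $x,x'>0$; (2) $\int\phi(G_x(\mathbf y))\boldsymbol\Xi(\mathrm d\mathbf y)=x^{-\alpha}\int\phi(\mathbf y)\boldsymbol\Xi(\mathrm d\mathbf y)$ for all $x>0$ and all continuous bounded $\phi:\mathcal E\to\mathbb R_+$; (3) for each $\mathbf y\in\mathcal E_0$, $x\mapsto x\,G_x(\mathbf y)$ is coordinate-wise non-decreasing; (4) $(x,\mathbf y)\mapsto G_x(\mathbf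 y)$ is continuous from $(0,\infty)\times\mathcal E_0$ to $\mathcal E_0$ (product topology on $\mathcal E_0$), and, $G^{(0)}$ being the coordinate of $G$ with index $0$, for every compact $K\subset(0,\infty)$ there is $C_K>0$ with $\int\big(x(G_x^{(0)}(\mathbf y)-1)-x'(G_{x'}^{(0)}(\mathbf y)-1)\big)^2\boldsymbol\Xi(\mathrm d\mathbf y)\le C_K(x-x')^2$ for all $x,x'\in K$. **Notation.** $\mathsf m_x(y)=\dfrac{xy}{xy+(1-y)}$ for $x>0$, $y\in[0,1]$. For $\gamma\ne0$, $\nu_\gamma(\mathrm dy)=\mathbf 1_{[0,1]}(y)\dfrac{\mathrm dy}{y^{1-\gamma}(1-y)^{1+\gamma}}$. **Form $\mathsf M_\gamma$ (mass form), $\gamma>0$:** there is a non-trivial Borel measure $\boldsymbol\Theta$ on $\mathcal E^\downarrow$ such that for all Borel $F:\mathcal E\to\mathbb R_+$, $$\int_{\mathcal E}\boldsymbol\Xi(\mathrm dy_0,\mathrm d\mathbf y)F(y_0,\mathbf y)=\int_0^1\nu_\gamma(\mathrm dy_0)\int_{\mathcal E^\downarrow}\boldsymbol\Theta(\mathrm d\mathbf y)F(y_0,(1-y_0)\mathbf y).$$ **Form $\mathsf H_\gamma$ (height form), $\gamma>0$:** there is a non-trivial Borel measure $\boldsymbol\Theta$ on $\mathcal E^\downarrow$ such that for all Borel $F:\mathcal E\to\mathbb R_+$, $$\int_{\mathcal E}\boldsymbol\Xi(\mathrm dy_0,\mathrm d\mathbf y)F(y_0,\mathbf y)=\int_0^1\nu_{-\gamma}(\mathrm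 dy_0)\int_{\mathcal E^\downarrow}\boldsymbol\Theta(\mathrm d\mathbf y)F(1,y_0,y_0\cdot\mathbf y).$$ *)

theory Defs
  imports "HOL-Analysis.Analysis"
begin

section \<open>Spaces of sequences\<close>

text \<open>A pair consisting of a first coordinate and a sequence is encoded as \<open>case_nat a z\<close>.\<close>

definition seq_E :: "(nat \<Rightarrow> real) set" where
  "seq_E = {y. 0 < y 0 \<and> decseq (\<lambda>i. y (Suc i)) \<and> (\<forall>i. 0 \<le> y (Suc i)) \<and> y \<longlonglongrightarrow> 0}"

definition seq_E_down :: "(nat \<Rightarrow> real) set" where
  "seq_E_down = {y. decseq y \<and> (\<forall>i. 0 \<le> y i) \<and> y \<longlonglongrightarrow> 0}"

text \<open>
  The type class topology on \<^typ>\<open>nat \<Rightarrow> real\<close> is the product topology. The supremum norm is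
  the one of \<^typ>\<open>nat \<Rightarrow>\<^sub>C real\<close>: as \<^typ>\<open>nat\<close> is discrete, these are the bounded real sequences.
  Below, \<open>S\<close> is always a set of bounded sequences, so that \<^const>\<open>Bcontfun\<close> is injective on \<open>S\<close>.
\<close>

definition sup_topology :: "(nat \<Rightarrow> real) set \<Rightarrow> (nat \<Rightarrow> real) topology" where
  "sup_topology S = pullback_topology S Bcontfun euclidean"

definition sup_borel :: "(nat \<Rightarrow> real) set \<Rightarrow> (nat \<Rightarrow> real) measure" where
  "sup_borel S = sigma S {U. openin (sup_topology S) U}"

lemma topspace_sup_topology [simp]: "topspace (sup_topology S) = S"
  by (simp add: sup_topology_def topspace_pullback_topology)

lemma space_sup_borel [simp]: "space (sup_borel S) = S"
  by (simp add: sup_borel_def space_measure_of_conv)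

lemma sets_sup_borel: "sets (sup_borel S) = sigma_sets S {U. openin (sup_topology S) U}"
  using openin_subset[of "sup_topology S"]
  by (auto simp: sup_borel_def intro!: sets_measure_of)

lemma openin_sup_topology_iff:
  assumes "S \<subseteq> bcontfun"
  shows "openin (sup_topology S) U \<longleftrightarrow>
    U \<subseteq> S \<and> (\<forall>y\<in>U. \<exists>r>0. \<forall>z\<in>S. (SUP i. \<bar>z i - y i\<bar>) < r \<longrightarrow> z \<in> U)"
proof -
  have ap: "apply_bcontfun (Bcontfun y) = y" if "y \<in> S" for y
    using assms that by (auto simp: Bcontfun_inverse)
  have d: "dist (Bcontfun z) (Bcontfun y) = (SUP i. \<bar>z i - y i\<bar>)" if "z \<in> S" "y \<in> S" for y z
    using that by (simp add: dist_bcontfun.rep_eq ap dist_real_def)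
  show ?thesis
  proof safe
    assume *: "openin (sup_topology S) U"
    then obtain V where V: "open V" "U = Bcontfun -` V \<inter> S"
      by (auto simp: sup_topology_def openin_pullback_topology)
    show "y \<in> S" if "y \<in> U" for y using that V by auto
    fix y assume y: "y \<in> U"
    then obtain r where "r > 0" "\<And>f. dist f (Bcontfun y) < r \<Longrightarrow> f \<in> V"
      using V unfolding open_dist by blast
    then show "\<exists>r>0. \<forall>z\<in>S. (SUP i. \<bar>z i - y i\<bar>) < r \<longrightarrow> z \<in> U"
      using y V d by (intro exI[of _ r]) auto
  next
    assume *: "U \<subseteq> S" "\<forall>y\<in>U. \<exists>r>0. \<forall>z\<in>S. (SUP i. \<bar>z i - y i\<bar>) < r \<longrightarrow> z \<in> U"
    then obtain r where r: "\<And>y. y \<in> U \<Longrightarrow> r y > 0"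
        "\<And>y z. y \<in> U \<Longrightarrow> z \<in> S \<Longrightarrow> (SUP i. \<bar>z i - y i\<bar>) < r y \<Longrightarrow> z \<in> U"
      by metis
    have "U = Bcontfun -` (\<Union>y\<in>U. ball (Bcontfun y) (r y)) \<inter> S"
    proof (intro equalityI subsetI)
      fix z assume "z \<in> Bcontfun -` (\<Union>y\<in>U. ball (Bcontfun y) (r y)) \<inter> S"
      then obtain y where "z \<in> S" "y \<in> U" "dist (Bcontfun z) (Bcontfun y) < r y"
        by (auto simp: dist_commute)
      then show "z \<in> U" using r(2)[of y z] d[of z y] * by auto
    qed (use * r(1) in force)
    moreover have "open (\<Union>y\<in>U. ball (Bcontfun y) (r y))"
      by blast
    ultimately show "openin (sup_topology S) U"
      unfolding sup_topology_def openin_pullback_topology by auto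
  qed
qed

lemma seq_E_subset_bcontfun: "seq_E \<subseteq> bcontfun"
  using convergent_imp_bounded by (auto simp: seq_E_def bcontfun_def)

lemma seq_E_down_subset_bcontfun: "seq_E_down \<subseteq> bcontfun"
  using convergent_imp_bounded by (auto simp: seq_E_down_def bcontfun_def)


section \<open>Splitting measures and growing\<close>

definition splitting_measure :: "(nat \<Rightarrow> real) measure \<Rightarrow> bool" where
  "splitting_measure \<Xi> \<longleftrightarrow>
    sets \<Xi> = sets (sup_borel seq_E) \<and>
    (let \<Xi>\<^sub>0 = distr \<Xi> borel (\<lambda>y. y 0) in
      (\<integral>\<^sup>+ t. ennreal (min 1 ((ln t)\<^sup>2)) \<partial>\<Xi>\<^sub>0) < \<infinity> \<and>
      (\<integral>\<^sup>+ t. ennreal ((t - 1)\<^sup>2) \<partial>\<Xi>\<^sub>0) < \<infinity>) \<and>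
    (\<forall>\<epsilon>>0. emeasure \<Xi> {y \<in> seq_E. y 1 > \<epsilon>} < \<infinity>)"

text \<open>
  In the last but one condition, continuity refers to the type class (that is, product) topology of
  \<^typ>\<open>nat \<Rightarrow> real\<close>. All integrals are Lebesgue integrals of non-negative functions and may be
  infinite; in the scaling condition, equality is one in \<open>[0,\<infinity>]\<close>.
\<close>

definition growing ::
  "(nat \<Rightarrow> real) measure \<Rightarrow> real \<Rightarrow> (real \<Rightarrow> (nat \<Rightarrow> real) \<Rightarrow> nat \<Rightarrow> real) \<Rightarrow> bool" where
  "growing \<Xi> \<alpha> G \<longleftrightarrow>
    (\<forall>x>0. G x \<in> seq_E \<rightarrow> seq_E) \<and>
    (\<exists>E\<^sub>0 \<in> sets \<Xi>.
      E\<^sub>0 \<subseteq> seq_E \<and> emeasure \<Xi> (seq_E - E\<^sub>0) = 0 \<and>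
      (\<forall>y\<in>seq_E. G 1 y = y) \<and>
      (\<forall>x>0. \<forall>x'>0. \<forall>y\<in>seq_E. G x (G x' y) = G (x * x') y) \<and>
      (\<forall>x>0. \<forall>\<phi> :: (nat \<Rightarrow> real) \<Rightarrow> real.
        continuous_map (sup_topology seq_E) euclidean \<phi> \<and> bounded (\<phi> ` seq_E) \<and>
        (\<forall>y\<in>seq_E. 0 \<le> \<phi> y) \<longrightarrow>
        (\<integral>\<^sup>+ y. ennreal (\<phi> (G x y)) \<partial>\<Xi>) = ennreal (x powr (- \<alpha>)) * (\<integral>\<^sup>+ y. ennreal (\<phi> y) \<partial>\<Xi>)) \<and>
      (\<forall>y\<in>E\<^sub>0. \<forall>i. mono_on {0<..} (\<lambda>x. x * G x y i)) \<and>
      (\<forall>x>0. G x \<in> E\<^sub>0 \<rightarrow> E\<^sub>0) \<and>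
      continuous_on ({0<..} \<times> E\<^sub>0) (\<lambda>(x, y). G x y) \<and>
      (\<forall>K. compact K \<and> K \<subseteq> {0<..} \<longrightarrow>
        (\<exists>C>0. \<forall>x\<in>K. \<forall>x'\<in>K.
          (\<integral>\<^sup>+ y. ennreal ((x * (G x y 0 - 1) - x' * (G x' y 0 - 1))\<^sup>2) \<partial>\<Xi>)
            \<le> ennreal (C * (x - x')\<^sup>2))))"


section \<open>Mass form and height form\<close>

definition m_map :: "real \<Rightarrow> real \<Rightarrow> real" where
  "m_map x y = x * y / (x * y + (1 - y))"

definition nu :: "real \<Rightarrow> real measure" where
  "nu \<gamma> = density lborel
    (\<lambda>y. ennreal (indicator {0..1} y / (y powr (1 - \<gamma>) * (1 - y) powr (1 + \<gamma>))))"

definition form_M :: "real \<Rightarrow> (nat \<Rightarrow> real) measure \<Rightarrow> bool" where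
  "form_M \<gamma> \<Xi> \<longleftrightarrow>
    (\<exists>\<Theta>. sets \<Theta> = sets (sup_borel seq_E_down) \<and> emeasure \<Theta> seq_E_down \<noteq> 0 \<and>
      (\<forall>F :: (nat \<Rightarrow> real) \<Rightarrow> real.
        F \<in> borel_measurable (sup_borel seq_E) \<and> (\<forall>y\<in>seq_E. 0 \<le> F y) \<longrightarrow>
        (\<integral>\<^sup>+ y. ennreal (F y) \<partial>\<Xi>) =
        (\<integral>\<^sup>+ y\<^sub>0. (\<integral>\<^sup>+ z. ennreal (F (case_nat y\<^sub>0 (\<lambda>i. (1 - y\<^sub>0) * z i))) \<partial>\<Theta>) \<partial>nu \<gamma>)))"

text \<open>
  In the height form, the argument of \<open>F\<close> lies in \<^const>\<open>seq_E\<close> only if \<open>z 0 \<le> 1\<close>; the requirement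
  that this hold \<open>\<Theta>\<close>-almost everywhere is implicit in the integral being meaningful.
\<close>

definition form_H :: "real \<Rightarrow> (nat \<Rightarrow> real) measure \<Rightarrow> bool" where
  "form_H \<gamma> \<Xi> \<longleftrightarrow>
    (\<exists>\<Theta>. sets \<Theta> = sets (sup_borel seq_E_down) \<and> emeasure \<Theta> seq_E_down \<noteq> 0 \<and>
      (AE z in \<Theta>. z 0 \<le> 1) \<and>
      (\<forall>F :: (nat \<Rightarrow> real) \<Rightarrow> real.
        F \<in> borel_measurable (sup_borel seq_E) \<and> (\<forall>y\<in>seq_E. 0 \<le> F y) \<longrightarrow>
        (\<integral>\<^sup>+ y. ennreal (F y) \<partial>\<Xi>) =
        (\<integral>\<^sup>+ y\<^sub>0. (\<integral>\<^sup>+ z. ennreal (F (case_nat 1 (case_nat y\<^sub>0 (\<lambda>i. y\<^sub>0 * z i)))) \<partial>\<Theta>)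
          \<partial>nu (- \<gamma>))))"

definition dom_M :: "(nat \<Rightarrow> real) set" where
  "dom_M = {y \<in> seq_E. 0 < y 0 \<and> y 0 < 1}"

definition dom_H :: "(nat \<Rightarrow> real) set" where
  "dom_H = {y \<in> seq_E. y 0 = 1 \<and> 0 < y 1 \<and> y 1 < 1}"

definition G_M :: "real \<Rightarrow> (nat \<Rightarrow> real) \<Rightarrow> nat \<Rightarrow> real" where
  "G_M x y =
    (if y \<in> dom_M
     then case_nat (m_map x (y 0)) (\<lambda>i. (1 - m_map x (y 0)) / (1 - y 0) * y (Suc i))
     else y)"

definition G_H :: "real \<Rightarrow> (nat \<Rightarrow> real) \<Rightarrow> nat \<Rightarrow> real" where
  "G_H x y =
    (if y \<in> dom_H
     then case_nat 1 (case_nat (m_map (inverse x) (y 1))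
            (\<lambda>i. m_map (inverse x) (y 1) / y 1 * y (Suc (Suc i))))
     else y)"

end

theory Submission
  imports Defs
begin

text \<open>
  In terms of the odds \<open>u = y / (1 - y)\<close>, the map \<^term>\<open>m_map x\<close> is multiplication by \<open>x\<close> and the
  measure \<^term>\<open>nu c\<close> is \<open>u\<^sup>c du / u\<close>. Hence the maps \<^term>\<open>m_map x\<close> form a group action and scale
  \<^term>\<open>nu c\<close> by \<open>x powr - c\<close> (\<open>nn_integral_nu_m_map\<close>). A measure of mass form or of height form is
  parametrised by a point \<open>t\<close> of the unit interval, distributed according to \<^term>\<open>nu \<gamma>\<close> or
  \<^term>\<open>nu (- \<gamma>)\<close>, and a sequence \<open>z\<close>. In this parametrisation the growth maps act on \<open>t\<close> alone, by
  \<^term>\<open>m_map x\<close> in the mass form and by \<^term>\<open>m_map (inverse x)\<close> in the height form. This gives the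
  group property and the scaling relation, in both cases with exponent \<open>- \<gamma>\<close>
  (\<open>scaling_of_disintegration\<close>).

  Two points need care. The measure \<open>\<Theta>\<close> is arbitrary, so the inner integral need not be measurable
  in \<open>t\<close>; the change of variables holds nevertheless for all functions, because \<^term>\<open>m_map x\<close> is
  invertible and \<^const>\<open>nn_integral\<close> is a lower integral. The hypotheses on \<open>\<Xi>\<close> only speak of Borel
  functions, so the growth maps must be Borel for the supremum norm; they are in fact continuous on
  their domains, being combinations of the identity and a fixed unit sequence with coefficients
  that depend continuously on one coordinate (\<open>continuous_map_affine\<close>).

  Monotonicity, continuity and the Lipschitz condition follow from the explicit formulas. The
  last is trivial in the height form, where the entry of index \<open>0\<close> is constantly \<open>1\<close>, and reduces
  in the mass form to the integrability of \<open>(y 0 - 1)\<^sup>2\<close>.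
\<close>

section \<open>The odds-scaling maps and their action on the Beta-like densities\<close>

lemma m_map_denominator_pos:
  fixes x y :: real
  assumes "x > 0" "0 \<le> y" "y \<le> 1"
  shows "x * y + (1 - y) > 0"
proof (cases "y = 1")
  case False
  then have "y < 1" using assms by (simp add: less_le)
  then show ?thesis using assms by (intro add_nonneg_pos) auto
qed (use assms in auto)

lemma one_minus_m_map:
  assumes "x > 0" "0 \<le> y" "y \<le> 1"
  shows "1 - m_map x y = (1 - y) / (x * y + (1 - y))"
  using m_map_denominator_pos[OF assms] by (simp add: m_map_def field_simps)

text \<open>
  In terms of the odds \<open>y / (1 - y)\<close> the map \<^term>\<open>m_map x\<close> is multiplication by \<open>x\<close>, so these maps
  form a group action.
\<close>

lemma m_map_comp:
  assumes "x > 0" "x' > 0" "0 \<le> y" "y \<le> 1"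
  shows "m_map x (m_map x' y) = m_map (x * x') y"
proof -
  have "m_map x (m_map x' y) = x * m_map x' y / (x * m_map x' y + (1 - m_map x' y))"
    by (simp add: m_map_def)
  also have "\<dots> = (x * x' * y / (x' * y + (1 - y))) / ((x * x' * y + (1 - y)) / (x' * y + (1 - y)))"
    unfolding one_minus_m_map[OF assms(2-4)] by (simp add: m_map_def add_divide_distrib mult.assoc)
  also have "\<dots> = m_map (x * x') y"
    using m_map_denominator_pos[OF assms(2-4)] by (simp add: m_map_def)
  finally show ?thesis .
qed

lemma m_map_one [simp]: "m_map 1 y = y"
  by (simp add: m_map_def)

lemma m_map_in_unit_interval:
  assumes "x > 0" "0 < y" "y < 1"
  shows "0 < m_map x y" "m_map x y < 1"
  using assms m_map_denominator_pos[of x y] by (auto simp: m_map_def field_simps)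

lemma has_real_derivative_m_map:
  assumes "x > 0" "0 \<le> y" "y \<le> 1"
  shows "(m_map x has_real_derivative x / (x * y + (1 - y))\<^sup>2) (at y)"
  unfolding m_map_def[abs_def] using m_map_denominator_pos[OF assms]
  by (auto intro!: derivative_eq_intros simp: power2_eq_square field_simps)

lemma measurable_m_map [measurable]: "m_map x \<in> borel_measurable borel"
  unfolding m_map_def[abs_def] by measurable

lemma sets_nu [simp, measurable_cong]: "sets (nu c) = sets borel"
  by (simp add: nu_def)

lemma AE_nu: "AE y in nu c. 0 < y \<and> y < 1"
proof -
  have "AE y in lborel. y \<noteq> (0::real)" "AE y in lborel. y \<noteq> (1::real)"
    by (rule AE_lborel_singleton)+
  then have "AE y in lborel. 0 < ennreal (indicator {0..1} y / (y powr (1 - c) * (1 - y) powr (1 + c)))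
      \<longrightarrow> 0 < y \<and> y < 1"
    by eventually_elim (auto simp: indicator_def split: if_splits)
  then show ?thesis
    unfolding nu_def by (subst AE_density) auto
qed

text \<open>
  The density of \<^term>\<open>nu c\<close> is \<open>u\<^sup>c\<close> against \<open>du / u\<close> in the odds \<open>u = y / (1 - y)\<close>, hence it is
  homogeneous of degree \<open>c\<close> under \<^term>\<open>m_map x\<close>. In the coordinate \<open>y\<close> the Jacobian of
  \<^term>\<open>m_map x\<close> enters.
\<close>

lemma nu_density_m_map:
  fixes x y c :: real
  assumes x: "x > 0" and y: "0 < y" "y < 1"
  defines "w \<equiv> \<lambda>y. 1 / (y powr (1 - c) * (1 - y) powr (1 + c))"
  shows "w (m_map x y) * (x / (x * y + (1 - y))\<^sup>2) = x powr c * w y"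
proof -
  have key: "1 / ((x * y / d) powr (1 - c) * (e / d) powr (1 + c)) * (x / d\<^sup>2) =
      x powr c * (1 / (y powr (1 - c) * e powr (1 + c)))" if "d > 0" "e > 0" for d e :: real
  proof -
    have "d powr (1 - c) * d powr (1 + c) = d\<^sup>2"
      using that by (simp flip: powr_add powr_numeral)
    moreover have "x = x powr c * x powr (1 - c)"
      using x by (simp flip: powr_add)
    ultimately show ?thesis
      using x y that by (simp add: powr_divide powr_mult field_simps)
  qed
  have "m_map x y = x * y / (x * y + (1 - y))" by (simp add: m_map_def)
  then show ?thesis
    unfolding w_def using one_minus_m_map[of x y] key[of "x * y + (1 - y)" "1 - y"]
      m_map_denominator_pos[of x y] x y by simp
qed

lemma nn_integral_nu_m_map_measurable:
  assumes x: "x > 0" and g: "g \<in> borel_measurable borel"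
  shows "(\<integral>\<^sup>+ y. g (m_map x y) \<partial>nu c) = ennreal (x powr - c) * (\<integral>\<^sup>+ y. g y \<partial>nu c)"
proof -
  define w :: "real \<Rightarrow> real"
    where "w y = indicator {0..1} y / (y powr (1 - c) * (1 - y) powr (1 + c))" for y
  have [measurable]: "w \<in> borel_measurable borel"
    unfolding w_def[abs_def] by measurable
  have nu: "nu c = density lborel (\<lambda>y. ennreal (w y))"
    by (simp add: nu_def w_def)
  have w0: "w y \<ge> 0" for y by (auto simp: w_def indicator_def)
  have dist: "distr (nu c) borel (m_map x) = density (nu c) (\<lambda>_. ennreal (x powr - c))"
  proof (rule measure_eqI)
    fix A assume "A \<in> sets (distr (nu c) borel (m_map x))"
    then have [measurable]: "A \<in> sets borel" by simp
    define f where "f t = x powr - c * w t * indicator A t" for t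
    have f0: "f t \<ge> 0" for t by (auto simp: f_def w0)
    have [measurable]: "f \<in> borel_measurable borel"
      unfolding f_def[abs_def] by measurable
    have "emeasure (distr (nu c) borel (m_map x)) A = (\<integral>\<^sup>+ y. indicator A y \<partial>distr (nu c) borel (m_map x))"
      by simp
    also have "\<dots> = (\<integral>\<^sup>+ y. indicator A (m_map x y) \<partial>nu c)"
      by (subst nn_integral_distr) auto
    also have "\<dots> = (\<integral>\<^sup>+ y. ennreal (w y) * indicator A (m_map x y) \<partial>lborel)"
      unfolding nu by (subst nn_integral_density) auto
    also have "\<dots> = (\<integral>\<^sup>+ y. ennreal (f (m_map x y) * (x / (x * y + (1 - y))\<^sup>2) * indicator {0..1} y) \<partial>lborel)"
    proof (rule nn_integral_cong_AE)
      have "AE y in lborel. y \<noteq> (0::real)" "AE y in lborel. y \<noteq> (1::real)"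
        by (rule AE_lborel_singleton)+
      then show "AE y in lborel. ennreal (w y) * indicator A (m_map x y) =
        ennreal (f (m_map x y) * (x / (x * y + (1 - y))\<^sup>2) * indicator {0..1} y)"
      proof eventually_elim
        case (elim y)
        show ?case
        proof (cases "0 < y \<and> y < 1")
          case True
          then have "w (m_map x y) * (x / (x * y + (1 - y))\<^sup>2) = x powr c * w y"
            using nu_density_m_map[of x y c] x m_map_in_unit_interval[of x y]
            by (simp add: w_def)
          moreover have "x powr - c * x powr c = 1"
            using x by (simp flip: powr_add)
          ultimately have "x powr - c * w (m_map x y) * (x / (x * y + (1 - y))\<^sup>2) = w y"
            by (metis mult.assoc mult.left_neutral)
          then show ?thesis
            using True by (auto simp: f_def indicator_def)
        next
          case False
          then show ?thesis using elim by (auto simp: w_def)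
        qed
      qed
    qed
    \<comment> \<open>Substitution \<open>t = m_map x y\<close>; the endpoints \<open>0\<close> and \<open>1\<close> are fixed points.\<close>
    also have "\<dots> = (\<integral>\<^sup>+ t. ennreal (f t * indicator {m_map x 0..m_map x 1} t) \<partial>lborel)"
    proof (rule nn_integral_substitution[symmetric])
      show "continuous_on {0..1} (\<lambda>y. x / (x * y + (1 - y))\<^sup>2)"
        using m_map_denominator_pos[of x] x
        by (intro continuous_intros) (auto simp: less_le)
      show "set_borel_measurable borel {m_map x 0..m_map x 1} f"
        unfolding set_borel_measurable_def by measurable
    qed (use x has_real_derivative_m_map[of x] in auto)
    also have "\<dots> = (\<integral>\<^sup>+ t. ennreal (w t) * (ennreal (x powr - c) * indicator A t) \<partial>lborel)"
      using x by (intro nn_integral_cong)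
        (auto simp: f_def w_def m_map_def indicator_def ennreal_mult' mult.commute simp flip: ennreal_mult')
    also have "\<dots> = (\<integral>\<^sup>+ t. ennreal (x powr - c) * indicator A t \<partial>nu c)"
      unfolding nu by (subst nn_integral_density) auto
    also have "\<dots> = emeasure (density (nu c) (\<lambda>_. ennreal (x powr - c))) A"
      by (subst emeasure_density) auto
    finally show "emeasure (distr (nu c) borel (m_map x)) A =
      emeasure (density (nu c) (\<lambda>_. ennreal (x powr - c))) A" .
  qed simp
  have "(\<integral>\<^sup>+ y. g (m_map x y) \<partial>nu c) = (\<integral>\<^sup>+ y. g y \<partial>distr (nu c) borel (m_map x))"
    using g by (subst nn_integral_distr) auto
  also have "\<dots> = ennreal (x powr - c) * (\<integral>\<^sup>+ y. g y \<partial>nu c)"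
    unfolding dist using g by (subst nn_integral_density) (auto simp: nn_integral_cmult)
  finally show ?thesis .
qed

text \<open>
  The function \<open>h\<close> is arbitrary, since the inner integral of a disintegration need not depend
  measurably on the outer variable. The integral of a non-measurable function is the supremum over the
  simple functions below it, and composing these with \<^term>\<open>m_map x\<close> yields measurable functions below
  the composition of \<open>h\<close>; this gives one inequality.
\<close>

lemma nn_integral_nu_m_map_ge:
  assumes x: "x > 0"
  shows "ennreal (x powr - c) * (\<integral>\<^sup>+ y. h y \<partial>nu c) \<le> (\<integral>\<^sup>+ y. h (m_map x y) \<partial>nu c)"
  unfolding nn_integral_def[of "nu c" h] SUP_mult_left_ennreal
proof (rule SUP_least)
  fix g assume "g \<in> {g. simple_function (nu c) g \<and> g \<le> h}"
  then have g: "simple_function (nu c) g" "g \<le> h" by auto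
  then have [measurable]: "g \<in> borel_measurable borel"
    using borel_measurable_simple_function[of "nu c" g] measurable_cong_sets[OF sets_nu refl] by blast
  have "ennreal (x powr - c) * integral\<^sup>S (nu c) g = (\<integral>\<^sup>+ y. g (m_map x y) \<partial>nu c)"
    using g x by (simp add: nn_integral_nu_m_map_measurable nn_integral_eq_simple_integral)
  also have "\<dots> \<le> (\<integral>\<^sup>+ y. h (m_map x y) \<partial>nu c)"
    using g by (intro nn_integral_mono) (auto simp: le_fun_def)
  finally show "ennreal (x powr - c) * integral\<^sup>S (nu c) g \<le> (\<integral>\<^sup>+ y. h (m_map x y) \<partial>nu c)" .
qed

text \<open>
  The reverse inequality is the previous one for the inverse map.
\<close>

lemma nn_integral_nu_m_map:
  assumes x: "x > 0"
  shows "(\<integral>\<^sup>+ y. h (m_map x y) \<partial>nu c) = ennreal (x powr - c) * (\<integral>\<^sup>+ y. h y \<partial>nu c)"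
proof (rule antisym)
  have "AE y in nu c. m_map x (m_map (inverse x) y) = y"
    using AE_nu by eventually_elim (use x in \<open>simp add: m_map_comp\<close>)
  then have "(\<integral>\<^sup>+ y. h (m_map x (m_map (inverse x) y)) \<partial>nu c) = (\<integral>\<^sup>+ y. h y \<partial>nu c)"
    by (intro nn_integral_cong_AE) auto
  then have "ennreal (x powr c) * (\<integral>\<^sup>+ y. h (m_map x y) \<partial>nu c) \<le> (\<integral>\<^sup>+ y. h y \<partial>nu c)"
    using nn_integral_nu_m_map_ge[of "inverse x" c "\<lambda>y. h (m_map x y)"] x
    by (simp add: powr_minus inverse_powr)
  then have "ennreal (x powr - c) * (ennreal (x powr c) * (\<integral>\<^sup>+ y. h (m_map x y) \<partial>nu c)) \<le>
      ennreal (x powr - c) * (\<integral>\<^sup>+ y. h y \<partial>nu c)"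
    by (rule mult_left_mono) simp
  moreover have "ennreal (x powr - c) * ennreal (x powr c) = 1"
    using x by (simp flip: ennreal_mult powr_add)
  ultimately show "(\<integral>\<^sup>+ y. h (m_map x y) \<partial>nu c) \<le> ennreal (x powr - c) * (\<integral>\<^sup>+ y. h y \<partial>nu c)"
    by (simp flip: mult.assoc)
qed (rule nn_integral_nu_m_map_ge[OF x])

section \<open>Continuity and measurability for the supremum norm\<close>

lemma continuous_on_eval_bcontfun:
  fixes k :: "'a :: topological_space"
  shows "continuous_on X (\<lambda>f :: 'a \<Rightarrow>\<^sub>C 'b :: metric_space. apply_bcontfun f k)"
proof (rule continuous_on_subset[OF _ subset_UNIV], unfold continuous_on_iff, safe)
  fix f :: "'a \<Rightarrow>\<^sub>C 'b" and e :: real assume "e > 0"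
  then show "\<exists>d>0. \<forall>g\<in>UNIV. dist g f < d \<longrightarrow> dist (apply_bcontfun g k) (apply_bcontfun f k) < e"
    using dist_fun_lt_imp_dist_val_lt by blast
qed

text \<open>
  Through \<^const>\<open>Bcontfun\<close>, continuity for the supremum norm becomes \<^const>\<open>continuous_on\<close> in a
  normed space, where the usual rules for sums and multiples apply.
\<close>

lemma continuous_map_comp_Bcontfun:
  assumes "continuous_on (Bcontfun ` D) g"
  shows "continuous_map (subtopology (sup_topology S) D) euclidean (\<lambda>y. g (Bcontfun y))"
proof -
  have "continuous_map (sup_topology S) euclidean (id \<circ> Bcontfun)"
    unfolding sup_topology_def by (rule continuous_map_pullback) simp
  then have "continuous_map (subtopology (sup_topology S) D) (top_of_set (Bcontfun ` D)) Bcontfun"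
    by (intro continuous_map_into_subtopology continuous_map_from_subtopology) auto
  moreover have "continuous_map (top_of_set (Bcontfun ` D)) euclidean g"
    using assms by simp
  ultimately show ?thesis
    using continuous_map_compose[of _ _ Bcontfun _ g] by (simp add: o_def)
qed

lemma continuous_map_coordinate:
  assumes "S \<subseteq> bcontfun"
  shows "continuous_map (sup_topology S) euclidean (\<lambda>y. y k)"
proof -
  have "continuous_map (subtopology (sup_topology S) S) euclidean (\<lambda>y. apply_bcontfun (Bcontfun y) k)"
    by (rule continuous_map_comp_Bcontfun[OF continuous_on_eval_bcontfun])
  then have "continuous_map (sup_topology S) euclidean (\<lambda>y. apply_bcontfun (Bcontfun y) k)"
    using subtopology_topspace[of "sup_topology S"] by simp
  then show ?thesis
    by (rule continuous_map_eq) (use assms in \<open>auto simp: Bcontfun_inverse\<close>)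
qed

lemma borel_measurable_sup_borel_if:
  assumes D: "D \<in> sets (sup_borel S)"
    and f: "continuous_map (subtopology (sup_topology S) D) euclidean f"
    and g: "g \<in> borel_measurable (sup_borel S)"
  shows "(\<lambda>y. if y \<in> D then f y else g y) \<in> borel_measurable (sup_borel S)"
proof -
  have DS: "D \<subseteq> S" using sets.sets_into_space[OF D] by simp
  have "f \<in> borel_measurable (restrict_space (sup_borel S) D)"
  proof (rule borel_measurableI)
    fix U :: "'a set" assume "open U"
    then have "openin (subtopology (sup_topology S) D) {y \<in> D. f y \<in> U}"
      using openin_continuous_map_preimage[OF f, of U] DS by (simp add: Int_absorb1)
    then obtain V where V: "openin (sup_topology S) V" "{y \<in> D. f y \<in> U} = V \<inter> D"
      by (auto simp: openin_subtopology)
    then have "V \<in> sets (sup_borel S)" by (auto simp: sets_sup_borel)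
    moreover have "f -` U \<inter> space (restrict_space (sup_borel S) D) = V \<inter> D"
      using V(2) DS by (auto simp: space_restrict_space)
    ultimately show "f -` U \<inter> space (restrict_space (sup_borel S) D) \<in> sets (restrict_space (sup_borel S) D)"
      by (auto simp: sets_restrict_space)
  qed
  then show ?thesis
    using D DS g
    by (subst measurable_If_restrict_space_iff)
       (auto intro: measurable_restrict_space1 simp: Int_absorb1 Collect_conj_eq)
qed

lemma borel_measurable_sup_borel_continuous:
  assumes "continuous_map (sup_topology S) euclidean f"
  shows "f \<in> borel_measurable (sup_borel S)"
proof -
  have S: "S \<in> sets (sup_borel S)" using sets.top[of "sup_borel S"] by simp
  have "(\<lambda>y. if y \<in> S then f y else f undefined) \<in> borel_measurable (sup_borel S)"
    using borel_measurable_sup_borel_if[OF S, of f "\<lambda>_. f undefined"] assms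
    by (simp add: continuous_map_from_subtopology)
  then show ?thesis
    by (rule measurable_cong[THEN iffD1, rotated]) simp
qed

lemma measurable_coordinate [measurable]:
  "(\<lambda>y. y k) \<in> borel_measurable (sup_borel seq_E)"
  by (intro borel_measurable_sup_borel_continuous continuous_map_coordinate seq_E_subset_bcontfun)

text \<open>
  On their domains, both growth maps multiply the whole sequence \<open>y\<close> by a scalar and correct the entry
  of index \<open>0\<close>, where the scalar and the correction depend on a single coordinate \<open>y k\<close> only. Such a
  map is a combination of \<open>y\<close> and a fixed unit sequence with continuous coefficients.
\<close>

lemma continuous_map_affine:
  assumes D: "D \<subseteq> seq_E" and I: "\<And>y. y \<in> D \<Longrightarrow> y k \<in> I"
    and ab: "continuous_on I a" "continuous_on I b"
    and T: "\<And>y. y \<in> D \<Longrightarrow> T y \<in> seq_E"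
    and eq: "\<And>y i. y \<in> D \<Longrightarrow> T y i = a (y k) * y i + b (y k) * of_bool (i = 0)"
  shows "continuous_map (subtopology (sup_topology seq_E) D) (sup_topology seq_E) T"
proof -
  define e :: "nat \<Rightarrow> real" where "e i = of_bool (i = 0)" for i
  have e: "e \<in> bcontfun"
    by (auto simp: bcontfun_def e_def intro!: boundedI[where B=1])
  have ap: "apply_bcontfun (Bcontfun y) = y" if "y \<in> seq_E" for y
    using that seq_E_subset_bcontfun by (auto simp: Bcontfun_inverse)
  define g :: "(nat \<Rightarrow>\<^sub>C real) \<Rightarrow> (nat \<Rightarrow>\<^sub>C real)" where
    "g f = a (apply_bcontfun f k) *\<^sub>R f + b (apply_bcontfun f k) *\<^sub>R Bcontfun e" for f
  have maps: "(\<lambda>f. apply_bcontfun f k) ` Bcontfun ` D \<subseteq> I"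
    using D I ap by (auto simp: subset_iff)
  have "continuous_on (Bcontfun ` D) g"
    unfolding g_def[abs_def] using maps
    by (intro continuous_intros continuous_on_eval_bcontfun
        continuous_on_compose2[OF ab(1)] continuous_on_compose2[OF ab(2)])
  then have "continuous_map (subtopology (sup_topology seq_E) D) euclidean (\<lambda>y. g (Bcontfun y))"
    by (rule continuous_map_comp_Bcontfun)
  moreover have "g (Bcontfun y) = (Bcontfun \<circ> T) y" if "y \<in> D" for y
    using that D T e eq by (intro bcontfun_eqI) (auto simp: g_def ap subset_iff Bcontfun_inverse e_def)
  ultimately have "continuous_map (subtopology (sup_topology seq_E) D) euclidean (Bcontfun \<circ> T)"
    by (rule continuous_map_eq) (use D in auto)
  then have "continuous_map (subtopology (sup_topology seq_E) D)
      (pullback_topology seq_E Bcontfun euclidean) T"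
    by (rule continuous_map_pullback') (use T in auto)
  then show ?thesis
    by (simp add: sup_topology_def)
qed

section \<open>Flows acting along the coordinate of a disintegration\<close>

text \<open>
  The map \<open>T\<close> moves \<open>P t z\<close> to \<open>P (m_map s t) z\<close>, so it leaves \<open>z\<close> alone and acts on \<open>t\<close> by
  \<^term>\<open>m_map s\<close>. The scaling of \<^term>\<open>nu c\<close> thus passes to \<open>\<Xi>\<close>. The inner integral is
  a function of \<open>t\<close> that is not known to be measurable, as \<open>\<Theta>\<close> is an arbitrary measure.
\<close>

lemma scaling_of_disintegration:
  fixes \<Xi> \<Theta> :: "(nat \<Rightarrow> real) measure" and P :: "real \<Rightarrow> (nat \<Rightarrow> real) \<Rightarrow> nat \<Rightarrow> real"
  assumes form: "\<And>F. F \<in> borel_measurable (sup_borel seq_E) \<Longrightarrow> \<forall>y\<in>seq_E. 0 \<le> F y \<Longrightarrow>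
      (\<integral>\<^sup>+ y. ennreal (F y) \<partial>\<Xi>) = (\<integral>\<^sup>+ t. (\<integral>\<^sup>+ z. ennreal (F (P t z)) \<partial>\<Theta>) \<partial>nu c)"
    and D: "D \<in> sets (sup_borel seq_E)"
    and PD: "\<And>t. 0 < t \<Longrightarrow> t < 1 \<Longrightarrow> AE z in \<Theta>. P t z \<in> D"
    and T: "continuous_map (subtopology (sup_topology seq_E) D) (sup_topology seq_E) T"
    and T_P: "\<And>t z. 0 < t \<Longrightarrow> t < 1 \<Longrightarrow> P t z \<in> D \<Longrightarrow> T (P t z) = P (m_map s t) z"
    and T_id: "\<And>y. y \<in> seq_E \<Longrightarrow> y \<notin> D \<Longrightarrow> T y = y"
    and T_E: "T \<in> seq_E \<rightarrow> seq_E"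
    and s: "s > 0"
    and \<phi>: "continuous_map (sup_topology seq_E) euclidean \<phi>" "\<forall>y\<in>seq_E. 0 \<le> \<phi> y"
    and sets: "sets \<Xi> = sets (sup_borel seq_E)"
  shows "(\<integral>\<^sup>+ y. ennreal (\<phi> (T y)) \<partial>\<Xi>) = ennreal (s powr - c) * (\<integral>\<^sup>+ y. ennreal (\<phi> y) \<partial>\<Xi>)"
proof -
  have \<phi>m: "\<phi> \<in> borel_measurable (sup_borel seq_E)"
    by (rule borel_measurable_sup_borel_continuous) fact
  have "continuous_map (subtopology (sup_topology seq_E) D) euclidean (\<phi> \<circ> T)"
    by (rule continuous_map_compose[OF T \<phi>(1)])
  from borel_measurable_sup_borel_if[OF D this \<phi>m]
  have "(\<lambda>y. \<phi> (T y)) \<in> borel_measurable (sup_borel seq_E)"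
    by (rule measurable_cong[THEN iffD1, rotated]) (auto simp: T_id)
  then have "(\<integral>\<^sup>+ y. ennreal (\<phi> (T y)) \<partial>\<Xi>) = (\<integral>\<^sup>+ t. (\<integral>\<^sup>+ z. ennreal (\<phi> (T (P t z))) \<partial>\<Theta>) \<partial>nu c)"
    using T_E \<phi>(2) by (intro form) auto
  also have "\<dots> = (\<integral>\<^sup>+ t. (\<integral>\<^sup>+ z. ennreal (\<phi> (P (m_map s t) z)) \<partial>\<Theta>) \<partial>nu c)"
  proof (rule nn_integral_cong_AE, use AE_nu in eventually_elim)
    case (elim t)
    with PD[of t] have "AE z in \<Theta>. \<phi> (T (P t z)) = \<phi> (P (m_map s t) z)"
      by (auto elim!: eventually_mono simp: T_P)
    then show ?case by (intro nn_integral_cong_AE) auto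
  qed
  also have "\<dots> = ennreal (s powr - c) * (\<integral>\<^sup>+ t. (\<integral>\<^sup>+ z. ennreal (\<phi> (P t z)) \<partial>\<Theta>) \<partial>nu c)"
    by (rule nn_integral_nu_m_map[OF s])
  also have "(\<integral>\<^sup>+ t. (\<integral>\<^sup>+ z. ennreal (\<phi> (P t z)) \<partial>\<Theta>) \<partial>nu c) = (\<integral>\<^sup>+ y. ennreal (\<phi> y) \<partial>\<Xi>)"
    using \<phi>m \<phi>(2) by (intro form[symmetric]) auto
  finally show ?thesis .
qed

lemma null_sets_of_disintegration:
  fixes \<Xi> \<Theta> :: "(nat \<Rightarrow> real) measure" and P :: "real \<Rightarrow> (nat \<Rightarrow> real) \<Rightarrow> nat \<Rightarrow> real"
  assumes form: "\<And>F. F \<in> borel_measurable (sup_borel seq_E) \<Longrightarrow> \<forall>y\<in>seq_E. 0 \<le> F y \<Longrightarrow>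
      (\<integral>\<^sup>+ y. ennreal (F y) \<partial>\<Xi>) = (\<integral>\<^sup>+ t. (\<integral>\<^sup>+ z. ennreal (F (P t z)) \<partial>\<Theta>) \<partial>nu c)"
    and D: "D \<in> sets (sup_borel seq_E)"
    and PD: "\<And>t. 0 < t \<Longrightarrow> t < 1 \<Longrightarrow> AE z in \<Theta>. P t z \<in> D"
    and sets: "sets \<Xi> = sets (sup_borel seq_E)"
  shows "seq_E - D \<in> null_sets \<Xi>"
proof -
  have N: "seq_E - D \<in> sets (sup_borel seq_E)"
    using sets.compl_sets[OF D] by simp
  have "emeasure \<Xi> (seq_E - D) = (\<integral>\<^sup>+ y. ennreal (indicator (seq_E - D) y) \<partial>\<Xi>)"
    using N sets by (simp add: ennreal_indicator)
  also have "\<dots> = (\<integral>\<^sup>+ t. (\<integral>\<^sup>+ z. ennreal (indicator (seq_E - D) (P t z)) \<partial>\<Theta>) \<partial>nu c)"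
    using N by (intro form) auto
  also have "\<dots> = (\<integral>\<^sup>+ t. 0 \<partial>nu c)"
  proof (rule nn_integral_cong_AE, use AE_nu in eventually_elim)
    case (elim t)
    with PD[of t] have "AE z in \<Theta>. ennreal (indicator (seq_E - D) (P t z)) = 0"
      by (auto elim!: eventually_mono)
    then have "(\<integral>\<^sup>+ z. ennreal (indicator (seq_E - D) (P t z)) \<partial>\<Theta>) = (\<integral>\<^sup>+ z. 0 \<partial>\<Theta>)"
      by (rule nn_integral_cong_AE)
    then show ?case by simp
  qed
  finally show ?thesis using N sets by auto
qed

section \<open>Sequences built by prepending an entry\<close>

lemma case_nat_in_seq_E:
  assumes "0 < d" "0 \<le> c" "z \<in> seq_E_down"
  shows "case_nat d (\<lambda>i. c * z i) \<in> seq_E"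
proof -
  have "(\<lambda>i. c * z i) \<longlonglongrightarrow> 0"
    using assms(3) tendsto_mult_right_zero[of z sequentially c] by (simp add: seq_E_down_def)
  then have "case_nat d (\<lambda>i. c * z i) \<longlonglongrightarrow> 0"
    by (subst filterlim_sequentially_Suc[symmetric]) simp
  then show ?thesis
    using assms by (auto simp: seq_E_def seq_E_down_def decseq_def intro: mult_left_mono)
qed

lemma tail_in_seq_E_down: "y \<in> seq_E \<Longrightarrow> (\<lambda>i. y (Suc i)) \<in> seq_E_down"
  by (auto simp: seq_E_def seq_E_down_def filterlim_sequentially_Suc)

lemma case_nat_in_seq_E_down:
  assumes "z \<in> seq_E_down" "z 0 \<le> d"
  shows "case_nat d z \<in> seq_E_down"
proof -
  have "case_nat d z \<longlonglongrightarrow> 0"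
    using assms by (subst filterlim_sequentially_Suc[symmetric]) (simp add: seq_E_down_def)
  moreover have "decseq (case_nat d z)"
    using assms by (auto simp: decseq_Suc_iff seq_E_down_def split: nat.split)
  moreover have "0 \<le> d" "\<forall>i. 0 \<le> z i"
    using assms order_trans[of 0 "z 0" d] by (auto simp: seq_E_down_def)
  ultimately show ?thesis
    using assms by (auto simp: seq_E_down_def split: nat.split)
qed

lemma measurable_dom_M: "dom_M \<in> sets (sup_borel seq_E)"
proof -
  have "{y \<in> space (sup_borel seq_E). 0 < y 0 \<and> y 0 < (1::real)} \<in> sets (sup_borel seq_E)"
    by measurable
  then show ?thesis by (simp add: dom_M_def)
qed

lemma measurable_dom_H: "dom_H \<in> sets (sup_borel seq_E)"
proof -
  have "{y \<in> space (sup_borel seq_E). y 0 = 1 \<and> 0 < y 1 \<and> y 1 < (1::real)} \<in> sets (sup_borel seq_E)"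
    by measurable
  then show ?thesis by (simp add: dom_H_def)
qed

section \<open>Mass form\<close>

lemma G_M_Suc: "y \<in> dom_M \<Longrightarrow> G_M x y (Suc i) = (1 - m_map x (y 0)) / (1 - y 0) * y (Suc i)"
  and G_M_0: "y \<in> dom_M \<Longrightarrow> G_M x y 0 = m_map x (y 0)"
  by (simp_all add: G_M_def)

lemma G_M_in_dom:
  assumes "x > 0" "y \<in> dom_M"
  shows "G_M x y \<in> dom_M"
proof -
  have y: "y \<in> seq_E" "0 < y 0" "y 0 < 1" using assms by (auto simp: dom_M_def)
  have "G_M x y = case_nat (m_map x (y 0)) (\<lambda>i. (1 - m_map x (y 0)) / (1 - y 0) * y (Suc i))"
    using assms by (simp add: G_M_def)
  also have "\<dots> \<in> seq_E"
    using m_map_in_unit_interval[of x "y 0"] assms(1) y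
    by (intro case_nat_in_seq_E tail_in_seq_E_down) auto
  finally show ?thesis
    using m_map_in_unit_interval[of x "y 0"] assms y by (simp add: dom_M_def G_M_0)
qed

lemma G_M_one: "G_M 1 y = y"
proof (cases "y \<in> dom_M")
  case True
  then have "G_M 1 y i = y i" for i
    by (cases i) (auto simp: G_M_0 G_M_Suc dom_M_def)
  then show ?thesis by blast
qed (simp add: G_M_def)

lemma G_M_comp:
  assumes "x > 0" "x' > 0"
  shows "G_M x (G_M x' y) = G_M (x * x') y"
proof (cases "y \<in> dom_M")
  case True
  then have y: "0 < y 0" "y 0 < 1" by (auto simp: dom_M_def)
  have T': "G_M x' y \<in> dom_M" using G_M_in_dom assms True by blast
  have "1 - m_map x' (y 0) \<noteq> 0"
    using m_map_in_unit_interval[of x' "y 0"] y assms by simp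
  then have "G_M x (G_M x' y) i = G_M (x * x') y i" for i
    using T' True assms y by (cases i) (simp_all add: G_M_0 G_M_Suc m_map_comp)
  then show ?thesis by blast
qed (simp add: G_M_def)

lemma continuous_map_G_M:
  assumes "x > 0"
  shows "continuous_map (subtopology (sup_topology seq_E) dom_M) (sup_topology seq_E) (G_M x)"
proof (rule continuous_map_affine[where k = 0 and I = "{0<..<1}"
      and a = "\<lambda>t. (1 - m_map x t) / (1 - t)"
      and b = "\<lambda>t. m_map x t - (1 - m_map x t) / (1 - t) * t"])
  show "continuous_on {0<..<1} (\<lambda>t. (1 - m_map x t) / (1 - t))"
       "continuous_on {0<..<1} (\<lambda>t. m_map x t - (1 - m_map x t) / (1 - t) * t)"
    using m_map_denominator_pos[OF assms] unfolding m_map_def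
    by (auto intro!: continuous_intros simp: less_le)
  fix y i assume y: "y \<in> dom_M"
  then show "G_M x y i = (1 - m_map x (y 0)) / (1 - y 0) * y i +
      (m_map x (y 0) - (1 - m_map x (y 0)) / (1 - y 0) * y 0) * of_bool (i = 0)"
    by (cases i) (simp_all add: G_M_0 G_M_Suc)
qed (use G_M_in_dom[OF assms] in \<open>auto simp: dom_M_def\<close>)

text \<open>
  With \<open>D = x * y 0 + (1 - y 0)\<close>, the entry of index \<open>0\<close> of \<^term>\<open>G_M x y\<close> is \<open>1 - (1 - y 0) / D\<close>,
  and the others are those of \<open>y\<close> divided by \<open>D\<close>. Both \<open>D\<close> and \<open>x / D\<close> increase with \<open>x\<close>.
\<close>

lemma mono_on_G_M:
  assumes "y \<in> dom_M"
  shows "mono_on {0<..} (\<lambda>x. x * G_M x y i)"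
proof (rule mono_onI)
  fix r s :: real assume rs: "r \<in> {0<..}" "s \<in> {0<..}" "r \<le> s"
  have y: "0 \<le> y (Suc j)" for j
    using assms by (auto simp: dom_M_def seq_E_def)
  have y0: "0 < y 0" "y 0 < 1" using assms by (auto simp: dom_M_def)
  have D: "0 < r * y 0 + (1 - y 0)" "0 < s * y 0 + (1 - y 0)"
    using m_map_denominator_pos[of r "y 0"] m_map_denominator_pos[of s "y 0"] rs y0 by auto
  show "r * G_M r y i \<le> s * G_M s y i"
  proof (cases i)
    case 0
    have "m_map r (y 0) \<le> m_map s (y 0)"
    proof -
      have "r * y 0 \<le> s * y 0" using rs y0 by (intro mult_right_mono) auto
      then have "(1 - y 0) / (s * y 0 + (1 - y 0)) \<le> (1 - y 0) / (r * y 0 + (1 - y 0))"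
        using D y0 by (intro divide_left_mono mult_pos_pos) auto
      then show ?thesis
        using one_minus_m_map[of r "y 0"] one_minus_m_map[of s "y 0"] rs y0 by simp
    qed
    then show ?thesis
      using 0 assms rs m_map_in_unit_interval[of r "y 0"] y0 by (simp add: G_M_0 mult_mono)
  next
    case (Suc j)
    have eq: "x * G_M x y i = x / (x * y 0 + (1 - y 0)) * y i" if "x > 0" for x
      using that y0 assms one_minus_m_map[of x "y 0"] Suc by (simp add: G_M_Suc)
    have "r / (r * y 0 + (1 - y 0)) \<le> s / (s * y 0 + (1 - y 0))"
    proof -
      have "r * (1 - y 0) \<le> s * (1 - y 0)" using rs y0 by (intro mult_right_mono) auto
      then show ?thesis using D by (simp add: divide_simps) (simp add: algebra_simps)
    qed
    then have "r / (r * y 0 + (1 - y 0)) * y i \<le> s / (s * y 0 + (1 - y 0)) * y i"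
      by (rule mult_right_mono) (use y Suc in auto)
    then show ?thesis using eq[of r] eq[of s] rs by simp
  qed
qed

lemma continuous_on_coordinate_snd:
  "continuous_on X (\<lambda>p :: 'a :: topological_space \<times> ('b \<Rightarrow> 'c :: topological_space). snd p i)"
  by (rule continuous_on_product_then_coordinatewise) (intro continuous_intros)

lemma continuous_on_G_M: "continuous_on ({0<..} \<times> dom_M) (\<lambda>(x, y). G_M x y)"
proof (rule continuous_on_coordinatewise_then_product)
  fix i
  have D: "fst p * snd p 0 + (1 - snd p 0) \<noteq> 0" "1 - snd p 0 \<noteq> 0" if "p \<in> {0<..} \<times> dom_M" for p
    using that m_map_denominator_pos[of "fst p" "snd p 0"] by (auto simp: dom_M_def)
  have "continuous_on ({0<..} \<times> dom_M) (\<lambda>p. if i = 0 then m_map (fst p) (snd p 0)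
     else (1 - m_map (fst p) (snd p 0)) / (1 - snd p 0) * snd p i)"
    unfolding m_map_def using D
    by (cases "i = 0") (auto intro!: continuous_intros continuous_on_coordinate_snd)
  then show "continuous_on ({0<..} \<times> dom_M) (\<lambda>p. (case p of (x, y) \<Rightarrow> G_M x y) i)"
    by (rule continuous_on_cong[THEN iffD1, OF refl, rotated]) (cases i; auto simp: G_M_0 G_M_Suc)
qed

text \<open>
  With \<open>d = x * y + (1 - y)\<close> and \<open>d'\<close> likewise for \<open>x'\<close>, the difference to be squared is
  \<open>- (1 - y)\<^sup>2 * (x - x') / (d * d')\<close>, and both denominators are at least \<open>a\<close>. One of the two factors
  \<open>(1 - y)\<^sup>2\<close> that arise is kept, since it is the one that is integrable for a splitting measure.
\<close>

lemma drift_G_M_Lipschitz: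
  fixes a x x' y :: real
  assumes "0 < a" "a \<le> 1" "a \<le> x" "a \<le> x'" "0 < y" "y < 1"
  shows "(x * (m_map x y - 1) - x' * (m_map x' y - 1))\<^sup>2 \<le> (y - 1)\<^sup>2 / a ^ 4 * (x - x')\<^sup>2"
proof -
  define d where "d = x * y + (1 - y)"
  define d' where "d' = x' * y + (1 - y)"
  have ge: "a \<le> u * y + (1 - y)" if "a \<le> u" for u
  proof -
    have "a * y \<le> u * y" "a * (1 - y) \<le> 1 * (1 - y)"
      using assms that by (intro mult_right_mono; simp)+
    then show ?thesis by (simp add: algebra_simps)
  qed
  have d: "a \<le> d" "a \<le> d'" using ge assms by (auto simp: d_def d'_def)
  have m: "m_map x y - 1 = - ((1 - y) / d)" "m_map x' y - 1 = - ((1 - y) / d')"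
    using one_minus_m_map[of x y] one_minus_m_map[of x' y] assms by (auto simp: d_def d'_def)
  have "x * (m_map x y - 1) - x' * (m_map x' y - 1) = - ((1 - y) * (x * d' - x' * d) / (d * d'))"
    unfolding m using d assms by (simp add: field_simps)
  also have "x * d' - x' * d = (1 - y) * (x - x')"
    by (simp add: d_def d'_def algebra_simps)
  finally have "(x * (m_map x y - 1) - x' * (m_map x' y - 1))\<^sup>2 =
      (1 - y)\<^sup>2 * (1 - y)\<^sup>2 * (x - x')\<^sup>2 / (d * d')\<^sup>2"
    by (simp add: power_divide power_mult_distrib)
  also have "\<dots> \<le> 1 * (1 - y)\<^sup>2 * (x - x')\<^sup>2 / (a * a)\<^sup>2"
    using assms d by (intro frac_le mult_right_mono power_mono mult_mono) (auto simp: power_le_one)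
  also have "\<dots> = (y - 1)\<^sup>2 / a ^ 4 * (x - x')\<^sup>2"
    by (simp add: power2_commute[of 1 y] power_mult_distrib flip: power_mult power_add)
  finally show ?thesis .
qed

lemma compact_positive_lower_bound:
  assumes "compact K" "K \<subseteq> {0<..}"
  obtains a :: real where "0 < a" "a \<le> 1" "\<And>x. x \<in> K \<Longrightarrow> a \<le> x"
proof (cases "K = {}")
  case False
  then obtain m where "m \<in> K" "\<And>x. x \<in> K \<Longrightarrow> m \<le> x"
    using compact_attains_inf[OF assms(1)] by blast
  then show ?thesis using assms(2) that[of "min 1 m"] by (auto simp: min_le_iff_disj)
qed (use that[of 1] in auto)

text \<open>
  The set of full measure in the definition of growing is \<^const>\<open>dom_M\<close>. The Lipschitz constant
  comes from the second moment of \<open>y 0 - 1\<close>, finite for a splitting measure.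
\<close>

lemma growing_G_M:
  assumes split: "splitting_measure \<Xi>" and form: "form_M \<gamma> \<Xi>"
  shows "growing \<Xi> \<gamma> G_M" and "seq_E - dom_M \<in> null_sets \<Xi>"
proof -
  have sets: "sets \<Xi> = sets (sup_borel seq_E)"
    using split by (simp add: splitting_measure_def)
  from form obtain \<Theta> where \<Theta>: "sets \<Theta> = sets (sup_borel seq_E_down)"
    and F: "\<And>F. F \<in> borel_measurable (sup_borel seq_E) \<Longrightarrow> \<forall>y\<in>seq_E. 0 \<le> F y \<Longrightarrow>
      (\<integral>\<^sup>+ y. ennreal (F y) \<partial>\<Xi>) =
      (\<integral>\<^sup>+ t. (\<integral>\<^sup>+ z. ennreal (F (case_nat t (\<lambda>i. (1 - t) * z i))) \<partial>\<Theta>) \<partial>nu \<gamma>)"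
    unfolding form_M_def by blast
  have space: "space \<Theta> = seq_E_down" using sets_eq_imp_space_eq[OF \<Theta>] by simp
  have P: "AE z in \<Theta>. case_nat t (\<lambda>i. (1 - t) * z i) \<in> dom_M" if "0 < t" "t < 1" for t
    using that case_nat_in_seq_E[of t "1 - t"] by (intro AE_I2) (auto simp: dom_M_def space)
  show null: "seq_E - dom_M \<in> null_sets \<Xi>"
    by (rule null_sets_of_disintegration[OF F measurable_dom_M P sets])
  have maps: "G_M x \<in> seq_E \<rightarrow> seq_E" if "x > 0" for x
    using G_M_in_dom[OF that] by (auto simp: dom_M_def G_M_def)
  have AE: "AE y in \<Xi>. y \<in> dom_M"
    by (rule AE_I'[OF null]) (use sets_eq_imp_space_eq[OF sets] in auto)
  define I where "I = (\<integral>\<^sup>+ y. ennreal ((y 0 - 1)\<^sup>2) \<partial>\<Xi>)"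
  have [measurable]: "(\<lambda>y. y 0) \<in> borel_measurable \<Xi>"
    using measurable_coordinate[of 0] measurable_cong_sets[OF sets refl] by blast
  have "I = (\<integral>\<^sup>+ t. ennreal ((t - 1)\<^sup>2) \<partial>distr \<Xi> borel (\<lambda>y. y 0))"
    unfolding I_def by (subst nn_integral_distr) auto
  then have I: "I < \<infinity>"
    using split by (simp add: splitting_measure_def Let_def)
  have Lip: "\<exists>C>0. \<forall>x\<in>K. \<forall>x'\<in>K.
      (\<integral>\<^sup>+ y. ennreal ((x * (G_M x y 0 - 1) - x' * (G_M x' y 0 - 1))\<^sup>2) \<partial>\<Xi>)
        \<le> ennreal (C * (x - x')\<^sup>2)" if K: "compact K" "K \<subseteq> {0<..}" for K
  proof -
    obtain a where a: "0 < a" "a \<le> 1" "\<And>x. x \<in> K \<Longrightarrow> a \<le> x"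
      using compact_positive_lower_bound[OF K] by blast
    have "(\<integral>\<^sup>+ y. ennreal ((x * (G_M x y 0 - 1) - x' * (G_M x' y 0 - 1))\<^sup>2) \<partial>\<Xi>)
        \<le> ennreal ((enn2real I / a ^ 4 + 1) * (x - x')\<^sup>2)" if "x \<in> K" "x' \<in> K" for x x'
    proof -
      have "(\<integral>\<^sup>+ y. ennreal ((x * (G_M x y 0 - 1) - x' * (G_M x' y 0 - 1))\<^sup>2) \<partial>\<Xi>)
        \<le> (\<integral>\<^sup>+ y. ennreal ((y 0 - 1)\<^sup>2) * ennreal ((x - x')\<^sup>2 / a ^ 4) \<partial>\<Xi>)"
      proof (rule nn_integral_mono_AE, use AE in eventually_elim)
        case (elim y)
        then show ?case
          using drift_G_M_Lipschitz[of a x x' "y 0"] a that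
          by (auto simp: G_M_0 dom_M_def simp flip: ennreal_mult intro!: ennreal_leI)
      qed
      also have "\<dots> = I * ennreal ((x - x')\<^sup>2 / a ^ 4)"
        unfolding I_def by (rule nn_integral_multc) measurable
      also have "\<dots> = ennreal (enn2real I) * ennreal ((x - x')\<^sup>2 / a ^ 4)"
        using I by simp
      also have "\<dots> = ennreal (enn2real I * ((x - x')\<^sup>2 / a ^ 4))"
        by (rule ennreal_mult[symmetric]) auto
      also have "\<dots> \<le> ennreal ((enn2real I / a ^ 4 + 1) * (x - x')\<^sup>2)"
        by (intro ennreal_leI) (simp add: algebra_simps)
      finally show ?thesis .
    qed
    \<comment> \<open>The summand \<open>1\<close> makes the constant positive even if \<open>I = 0\<close>.\<close>
    moreover have "enn2real I / a ^ 4 + 1 > 0"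
      using a by (intro add_nonneg_pos) auto
    ultimately show ?thesis by blast
  qed
  have scaling: "(\<integral>\<^sup>+ y. ennreal (\<phi> (G_M x y)) \<partial>\<Xi>) = ennreal (x powr (- \<gamma>)) * (\<integral>\<^sup>+ y. ennreal (\<phi> y) \<partial>\<Xi>)"
    if x: "x > 0" and \<phi>: "continuous_map (sup_topology seq_E) euclidean \<phi>" "\<forall>y\<in>seq_E. 0 \<le> \<phi> y"
    for x and \<phi> :: "(nat \<Rightarrow> real) \<Rightarrow> real"
  proof (rule scaling_of_disintegration[OF F measurable_dom_M P continuous_map_G_M[OF x] _ _
        maps[OF x] x \<phi> sets])
    fix t :: real and z :: "nat \<Rightarrow> real"
    assume "0 < t" "t < 1" and dom: "case_nat t (\<lambda>i. (1 - t) * z i) \<in> dom_M"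
    then show "G_M x (case_nat t (\<lambda>i. (1 - t) * z i)) =
        case_nat (m_map x t) (\<lambda>i. (1 - m_map x t) * z i)"
      by (simp add: G_M_def)
  qed (simp_all add: G_M_def)
  show "growing \<Xi> \<gamma> G_M"
    unfolding growing_def
  proof (intro conjI bexI[of _ dom_M])
    show "emeasure \<Xi> (seq_E - dom_M) = 0" using null by auto
    show "dom_M \<subseteq> seq_E" by (auto simp: dom_M_def)
    show "dom_M \<in> sets \<Xi>" using measurable_dom_M sets by simp
    show "\<forall>y\<in>seq_E. G_M 1 y = y" by (simp add: G_M_one)
  qed (use maps scaling Lip G_M_comp mono_on_G_M G_M_in_dom continuous_on_G_M in auto)
qed

section \<open>Height form\<close>

text \<open>
  Since \<open>m_map (inverse x) (y 1) = m_map (inverse x) (y 1) / y 1 * y 1\<close>, all entries of positive index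
  are multiplied by the same factor.
\<close>

lemma G_H_Suc: "y \<in> dom_H \<Longrightarrow> G_H x y (Suc i) = m_map (inverse x) (y 1) / y 1 * y (Suc i)"
  and G_H_0: "y \<in> dom_H \<Longrightarrow> G_H x y 0 = 1"
  by (cases i; auto simp: G_H_def dom_H_def)+

lemma G_H_1: "y \<in> dom_H \<Longrightarrow> G_H x y (Suc 0) = m_map (inverse x) (y 1)"
  by (auto simp: G_H_def)

lemma G_H_in_dom:
  assumes "x > 0" "y \<in> dom_H"
  shows "G_H x y \<in> dom_H"
proof -
  have y: "y \<in> seq_E" "0 < y 1" "y 1 < 1" using assms by (auto simp: dom_H_def)
  have m: "0 < m_map (inverse x) (y 1)" "m_map (inverse x) (y 1) < 1"
    using m_map_in_unit_interval[of "inverse x" "y 1"] assms y by auto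
  have "G_H x y i = case_nat 1 (\<lambda>i. m_map (inverse x) (y 1) / y 1 * y (Suc i)) i" for i
    using assms by (cases i) (simp_all add: G_H_0 G_H_Suc del: One_nat_def)
  then have "G_H x y = case_nat 1 (\<lambda>i. m_map (inverse x) (y 1) / y 1 * y (Suc i))" ..
  also have "\<dots> \<in> seq_E"
    using m y by (intro case_nat_in_seq_E tail_in_seq_E_down) auto
  finally show ?thesis
    using m assms by (simp add: dom_H_def G_H_0 G_H_1)
qed

lemma G_H_one: "G_H 1 y = y"
proof (cases "y \<in> dom_H")
  case True
  then have "G_H 1 y i = y i" for i
    by (cases i) (auto simp: G_H_0 G_H_Suc dom_H_def)
  then show ?thesis by blast
qed (simp add: G_H_def)

lemma G_H_comp:
  assumes "x > 0" "x' > 0"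
  shows "G_H x (G_H x' y) = G_H (x * x') y"
proof (cases "y \<in> dom_H")
  case True
  then have y: "0 < y 1" "y 1 < 1" by (auto simp: dom_H_def)
  have T': "G_H x' y \<in> dom_H" using G_H_in_dom assms True by blast
  have m: "m_map (inverse x') (y 1) \<noteq> 0"
    using m_map_in_unit_interval[of "inverse x'" "y 1"] y assms by simp
  have comp: "m_map (inverse x) (m_map (inverse x') (y 1)) = m_map (inverse (x * x')) (y 1)"
    using m_map_comp[of "inverse x" "inverse x'" "y 1"] y assms by (simp add: mult.commute)
  have 1: "G_H x' y 1 = m_map (inverse x') (y 1)" using G_H_1[OF True] by simp
  have "G_H x (G_H x' y) i = G_H (x * x') y i" for i
  proof (cases i)
    case (Suc j)
    have "G_H x (G_H x' y) (Suc j) = m_map (inverse (x * x')) (y 1) / m_map (inverse x') (y 1) *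
        (m_map (inverse x') (y 1) / y 1 * y (Suc j))"
      unfolding G_H_Suc[OF T'] 1 comp G_H_Suc[OF True] ..
    also have "\<dots> = G_H (x * x') y (Suc j)"
      using m unfolding G_H_Suc[OF True] by simp
    finally show ?thesis using Suc by simp
  qed (simp add: G_H_0 T' True)
  then show ?thesis by blast
qed (simp add: G_H_def)

lemma continuous_map_G_H:
  assumes "x > 0"
  shows "continuous_map (subtopology (sup_topology seq_E) dom_H) (sup_topology seq_E) (G_H x)"
proof (rule continuous_map_affine[where k = 1 and I = "{0<..<1}"
      and a = "\<lambda>t. m_map (inverse x) t / t" and b = "\<lambda>t. 1 - m_map (inverse x) t / t"])
  have "inverse x * t + (1 - t) \<noteq> 0" if "t \<in> {0<..<1}" for t
    using m_map_denominator_pos[of "inverse x" t] assms that by auto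
  then show "continuous_on {0<..<1} (\<lambda>t. m_map (inverse x) t / t)"
       "continuous_on {0<..<1} (\<lambda>t. 1 - m_map (inverse x) t / t)"
    unfolding m_map_def by (intro continuous_intros; simp)+
  fix y i assume y: "y \<in> dom_H"
  then show "G_H x y i = m_map (inverse x) (y 1) / y 1 * y i +
      (1 - m_map (inverse x) (y 1) / y 1) * of_bool (i = 0)"
    by (cases i) (simp_all add: G_H_0 G_H_Suc, simp add: dom_H_def)
qed (use G_H_in_dom[OF assms] in \<open>auto simp: dom_H_def\<close>)

text \<open>
  An entry of \<^term>\<open>G_H x y\<close> of positive index, multiplied by \<open>x\<close>, is \<open>y i / (inverse x * y 1 + (1 - y 1))\<close>.
\<close>

lemma mono_on_G_H:
  assumes "y \<in> dom_H"
  shows "mono_on {0<..} (\<lambda>x. x * G_H x y i)"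
proof (rule mono_onI)
  fix r s :: real assume rs: "r \<in> {0<..}" "s \<in> {0<..}" "r \<le> s"
  have y: "0 < y 1" "y 1 < 1" "\<And>j. 0 \<le> y (Suc j)"
    using assms by (auto simp: dom_H_def seq_E_def)
  show "r * G_H r y i \<le> s * G_H s y i"
  proof (cases i)
    case 0
    then show ?thesis using assms rs by (simp add: G_H_0)
  next
    case (Suc j)
    have D: "0 < inverse x * y 1 + (1 - y 1)" if "x > 0" for x
      using m_map_denominator_pos[of "inverse x" "y 1"] that y by auto
    have eq: "x * G_H x y i = y i / (inverse x * y 1 + (1 - y 1))" if "x > 0" for x
      unfolding Suc G_H_Suc[OF assms] m_map_def using that y(1) by simp
    have "inverse s * y 1 \<le> inverse r * y 1"
      using rs y by (intro mult_right_mono le_imp_inverse_le) auto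
    then have "y i / (inverse r * y 1 + (1 - y 1)) \<le> y i / (inverse s * y 1 + (1 - y 1))"
      using D[of s] D[of r] rs y(3)[of j] Suc by (intro divide_left_mono mult_pos_pos) auto
    then show ?thesis using rs by (simp add: eq)
  qed
qed

lemma continuous_on_G_H: "continuous_on ({0<..} \<times> dom_H) (\<lambda>(x, y). G_H x y)"
proof (rule continuous_on_coordinatewise_then_product)
  fix i
  have D: "inverse (fst p) * snd p 1 + (1 - snd p 1) \<noteq> 0" "snd p 1 \<noteq> 0" "fst p \<noteq> 0"
    if "p \<in> {0<..} \<times> dom_H" for p
    using that m_map_denominator_pos[of "inverse (fst p)" "snd p 1"] by (auto simp: dom_H_def)
  have "continuous_on ({0<..} \<times> dom_H) (\<lambda>p. if i = 0 then 1
     else m_map (inverse (fst p)) (snd p 1) / snd p 1 * snd p i)"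
    unfolding m_map_def using D
    by (cases "i = 0") (auto intro!: continuous_intros continuous_on_coordinate_snd)
  then show "continuous_on ({0<..} \<times> dom_H) (\<lambda>p. (case p of (x, y) \<Rightarrow> G_H x y) i)"
    by (rule continuous_on_cong[THEN iffD1, OF refl, rotated]) (cases i; auto simp: G_H_0 G_H_Suc)
qed

text \<open>
  The parameter of the flow is \<open>inverse x\<close> and the reference measure is \<^term>\<open>nu (- \<gamma>)\<close>; the two sign
  changes cancel in the exponent of the scaling relation. The entry of index \<open>0\<close> is \<open>1\<close>
  almost everywhere, before and after the flow, so that the integral in the Lipschitz condition vanishes.
\<close>

lemma growing_G_H:
  assumes split: "splitting_measure \<Xi>" and form: "form_H \<gamma> \<Xi>"
  shows "growing \<Xi> \<gamma> G_H" and "seq_E - dom_H \<in> null_sets \<Xi>"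
proof -
  have sets: "sets \<Xi> = sets (sup_borel seq_E)"
    using split by (simp add: splitting_measure_def)
  from form obtain \<Theta> where \<Theta>: "sets \<Theta> = sets (sup_borel seq_E_down)" "AE z in \<Theta>. z 0 \<le> 1"
    and F: "\<And>F. F \<in> borel_measurable (sup_borel seq_E) \<Longrightarrow> \<forall>y\<in>seq_E. 0 \<le> F y \<Longrightarrow>
      (\<integral>\<^sup>+ y. ennreal (F y) \<partial>\<Xi>) =
      (\<integral>\<^sup>+ t. (\<integral>\<^sup>+ z. ennreal (F (case_nat 1 (case_nat t (\<lambda>i. t * z i)))) \<partial>\<Theta>) \<partial>nu (- \<gamma>))"
    unfolding form_H_def by blast
  have space: "space \<Theta> = seq_E_down" using sets_eq_imp_space_eq[OF \<Theta>(1)] by simp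
  have P: "AE z in \<Theta>. case_nat 1 (case_nat t (\<lambda>i. t * z i)) \<in> dom_H" if t: "0 < t" "t < 1" for t
    using \<Theta>(2) AE_space
  proof eventually_elim
    case (elim z)
    have "case_nat t (\<lambda>i. t * z i) = (\<lambda>i. t * case_nat 1 z i)"
      by (auto simp: fun_eq_iff split: nat.split)
    then have "case_nat 1 (case_nat t (\<lambda>i. t * z i)) \<in> seq_E"
      using case_nat_in_seq_E[of 1 t "case_nat 1 z"] case_nat_in_seq_E_down[of z 1] elim t
      by (simp add: space)
    then show ?case using t by (simp add: dom_H_def)
  qed
  show null: "seq_E - dom_H \<in> null_sets \<Xi>"
    by (rule null_sets_of_disintegration[OF F measurable_dom_H P sets])
  have maps: "G_H x \<in> seq_E \<rightarrow> seq_E" if "x > 0" for x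
    using G_H_in_dom[OF that] by (auto simp: dom_H_def G_H_def)
  have AE: "AE y in \<Xi>. y \<in> dom_H"
    by (rule AE_I'[OF null]) (use sets_eq_imp_space_eq[OF sets] in auto)
  have zero: "(\<integral>\<^sup>+ y. ennreal ((x * (G_H x y 0 - 1) - x' * (G_H x' y 0 - 1))\<^sup>2) \<partial>\<Xi>) = 0" for x x'
  proof -
    have "AE y in \<Xi>. ennreal ((x * (G_H x y 0 - 1) - x' * (G_H x' y 0 - 1))\<^sup>2) = 0"
      using AE by eventually_elim (simp add: G_H_0)
    then have "(\<integral>\<^sup>+ y. ennreal ((x * (G_H x y 0 - 1) - x' * (G_H x' y 0 - 1))\<^sup>2) \<partial>\<Xi>) = (\<integral>\<^sup>+ y. 0 \<partial>\<Xi>)"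
      by (rule nn_integral_cong_AE)
    then show ?thesis by simp
  qed
  have scaling: "(\<integral>\<^sup>+ y. ennreal (\<phi> (G_H x y)) \<partial>\<Xi>) = ennreal (x powr (- \<gamma>)) * (\<integral>\<^sup>+ y. ennreal (\<phi> y) \<partial>\<Xi>)"
    if x: "x > 0" and \<phi>: "continuous_map (sup_topology seq_E) euclidean \<phi>" "\<forall>y\<in>seq_E. 0 \<le> \<phi> y"
    for x and \<phi> :: "(nat \<Rightarrow> real) \<Rightarrow> real"
  proof -
    have ix: "inverse x > 0" using x by simp
    have "(\<integral>\<^sup>+ y. ennreal (\<phi> (G_H x y)) \<partial>\<Xi>) =
        ennreal (inverse x powr - (- \<gamma>)) * (\<integral>\<^sup>+ y. ennreal (\<phi> y) \<partial>\<Xi>)"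
    proof (rule scaling_of_disintegration[OF F measurable_dom_H P continuous_map_G_H[OF x] _ _
          maps[OF x] ix \<phi> sets])
      fix t :: real and z :: "nat \<Rightarrow> real"
      assume "0 < t" "t < 1" and dom: "case_nat 1 (case_nat t (\<lambda>i. t * z i)) \<in> dom_H"
      then show "G_H x (case_nat 1 (case_nat t (\<lambda>i. t * z i))) =
          case_nat 1 (case_nat (m_map (inverse x) t) (\<lambda>i. m_map (inverse x) t * z i))"
        by (simp add: G_H_def)
    qed (simp_all add: G_H_def)
    then show ?thesis using x by (simp add: powr_minus inverse_powr)
  qed
  show "growing \<Xi> \<gamma> G_H"
    unfolding growing_def
  proof (intro conjI bexI[of _ dom_H])
    show "emeasure \<Xi> (seq_E - dom_H) = 0" using null by auto
    show "dom_H \<subseteq> seq_E" by (auto simp: dom_H_def)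
    show "dom_H \<in> sets \<Xi>" using measurable_dom_H sets by simp
    show "\<forall>y\<in>seq_E. G_H 1 y = y" by (simp add: G_H_one)
    show "\<forall>K. compact K \<and> K \<subseteq> {0<..} \<longrightarrow> (\<exists>C>0. \<forall>x\<in>K. \<forall>x'\<in>K.
        (\<integral>\<^sup>+ y. ennreal ((x * (G_H x y 0 - 1) - x' * (G_H x' y 0 - 1))\<^sup>2) \<partial>\<Xi>)
          \<le> ennreal (C * (x - x')\<^sup>2))"
      unfolding zero by (auto intro: exI[of _ 1])
  qed (use maps scaling G_H_comp mono_on_G_H G_H_in_dom continuous_on_G_H in auto)
qed

section \<open>Both forms are growing\<close>

theorem proposition4p1:
  fixes \<gamma> :: real and \<Xi> :: "(nat \<Rightarrow> real) measure"
  assumes "\<gamma> > 0" and "splitting_measure \<Xi>"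
  shows "(form_M \<gamma> \<Xi> \<longrightarrow> growing \<Xi> \<gamma> G_M \<and> seq_E - dom_M \<in> null_sets \<Xi>) \<and>
         (form_H \<gamma> \<Xi> \<longrightarrow> growing \<Xi> \<gamma> G_H \<and> seq_E - dom_H \<in> null_sets \<Xi>)"
  using growing_G_M growing_G_H assms by blast

end
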